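(* There is an absolute constant $C>0$ such that the following holds. Let $p$ be a prime, let $g$ be a primitive root modulo $p$, and let $N, K, M, H$ be any integers with $1\le N<p$ and $1\le K<p$. Let $J$ denote the number of integers $x\in[H+1,H+K]$ such that $g^x$ is congruent modulo $p$ to some integer in $[M+1,M+N]$. Then $$\left|J-\frac{KN}{p}\right|\le C\left(\frac{K^{1/2}N^{1/2}}{p^{1/4}}+p^{1/2}\right).$$
   Context: For a negative integer $x$, $g^x$ is understood modulo $p$, i.e. as a power of the inverse of $g$ modulo $p$. *)

theory Defs
  imports Complex_Main "HOL-Number_Theory.Number_Theory" "HOL-Number_Theory.Modular_Inverse"
begin

text \<open>
  An integer representative of the residue class of $g^x$ modulo $m$, meant for $g$ coprime to $m$.
  The result is not reduced modulo $m$ and is only meant to be compared by congruence.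
\<close>
definition int_pow_mod :: "int \<Rightarrow> int \<Rightarrow> int \<Rightarrow> int" where
  "int_pow_mod m g x =
     (if x \<ge> 0 then g ^ nat x else modular_inverse m g ^ nat (- x))"

text \<open>
  \<open>residue_primroot\<close> is only available for natural numbers; an integer is a primitive
  root iff its least nonnegative residue is.
\<close>
definition int_residue_primroot :: "nat \<Rightarrow> int \<Rightarrow> bool" where
  "int_residue_primroot p g \<longleftrightarrow> residue_primroot p (nat (g mod int p))"

end

theory Submission
  imports Defs "HOL-Analysis.Convex"
begin

text \<open>
  By a second moment computation over all lines, a family of points and a family of distinct lines
  \<open>b s = t + c\<close> modulo $p$ have $|P||L|/p + O(\sqrt{p|P||L|})$ incidences. Apply this to the points
  $(g^{x_1}, y_1)$ and the lines with parameters $(g^{x_2}, z)$, where $x_1, y_1$ range over long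
  intervals and $x_2 \in [1, k]$, $z \in [1, n]$: an incidence means $g^{x_1+x_2} \equiv y_1 + z$.
  If the long intervals are the given ones enlarged (shrunk) by $k$ and $n$, then the number of
  incidences is at least (at most) $knJ$. This bounds $J$ by
  $(K \pm k)(N \pm n)/p + O(\sqrt{pKN/(kn)})$, and $k \approx \alpha K$, $n \approx \alpha N$
  with $\alpha = \min(1, p^{3/4}/\sqrt{KN})$ balances the two errors without logarithms.
\<close>

section \<open>Incidences between points and lines modulo \<open>p\<close>\<close>

text \<open>With \<open>l = (b, c)\<close> and \<open>z = (s, t)\<close> this is the line t = b s -
  c of slope \<open>b\<close>. Vertical lines do not occur, so modulo a prime there are exactly p^2
  lines, one for each pair of residues.\<close>

definition incident :: "int \<Rightarrow> int \<times> int \<Rightarrow> int \<times> int \<Rightarrow> bool" where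
  "incident p l z \<longleftrightarrow> [fst l * fst z = snd z + snd l] (mod p)"

text \<open>Each of the \<open>p\<close> slopes \<open>b\<close> leaves exactly one choice of
  \<open>c\<close>, the residue of b s - t.\<close>

lemma card_lines_through:
  fixes p :: int
  assumes p: "p > 0"
  shows "(\<Sum>l\<in>{0..<p} \<times> {0..<p}. of_bool (incident p l z)) = real_of_int p"
proof -
  have "(\<Sum>c\<in>{0..<p}. of_bool (incident p (b, c) z)) = (1::real)" for b
  proof -
    define c0 where "c0 = (b * fst z - snd z) mod p"
    have "incident p (b, c) z \<longleftrightarrow> c = c0" if "c \<in> {0..<p}" for c
    proof -
      have "incident p (b, c) z \<longleftrightarrow> p dvd (b * fst z - snd z) - c"
        by (simp add: incident_def cong_iff_dvd_diff algebra_simps)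
      also have "\<dots> \<longleftrightarrow> c = c0"
        using that unfolding c0_def mod_eq_dvd_iff[symmetric] by auto
      finally show ?thesis .
    qed
    hence "(\<Sum>c\<in>{0..<p}. of_bool (incident p (b, c) z)) = (\<Sum>c\<in>{0..<p}. of_bool (c = c0) :: real)"
      by (intro sum.cong) auto
    also have "\<dots> = 1"
      using p by (simp add: of_bool_def c0_def)
    finally show ?thesis .
  qed
  then show ?thesis
    using p by (subst sum.cartesian_product') simp
qed

text \<open>Subtracting the two incidences gives b (s - s') = t - t'. If s and s' differ modulo
  \<open>p\<close>, this fixes \<open>b\<close> and then \<open>c\<close>. If they agree, then t and
  t' would have to agree too, so distinct points with the same first coordinate have no common line;
  hence an inequality only.\<close>

lemma card_lines_through_two:
  fixes p :: int
  assumes p: "prime p"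
  assumes ne: "\<not> ([fst z = fst z'] (mod p) \<and> [snd z = snd z'] (mod p))"
  shows "(\<Sum>l\<in>{0..<p} \<times> {0..<p}. of_bool (incident p l z \<and> incident p l z')) \<le> (1 :: real)"
proof -
  let ?S = "{l \<in> {0..<p} \<times> {0..<p}. incident p l z \<and> incident p l z'}"
  have "l = l'" if l: "l \<in> ?S" and l': "l' \<in> ?S" for l l'
  proof -
    obtain b c b' c' where [simp]: "l = (b, c)" "l' = (b', c')"
      by (cases l; cases l')
    have d: "p dvd b * fst z - (snd z + c)" "p dvd b * fst z' - (snd z' + c)"
      "p dvd b' * fst z - (snd z + c')" "p dvd b' * fst z' - (snd z' + c')"
      using l l' by (auto simp: incident_def cong_iff_dvd_diff)
    have 1: "p dvd b * (fst z - fst z') - (snd z - snd z')"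
      using dvd_diff[OF d(1,2)] by (simp add: algebra_simps)
    have 2: "p dvd b' * (fst z - fst z') - (snd z - snd z')"
      using dvd_diff[OF d(3,4)] by (simp add: algebra_simps)
    have "p dvd (b - b') * (fst z - fst z')"
      using dvd_diff[OF 1 2] by (simp add: algebra_simps)
    hence "p dvd b - b' \<or> p dvd fst z - fst z'"
      using p by (simp add: prime_dvd_mult_iff)
    moreover have "\<not> p dvd fst z - fst z'"
    proof
      assume *: "p dvd fst z - fst z'"
      hence "p dvd snd z - snd z'"
        using 1 by (metis dvd_diff_right_iff dvd_mult)
      with * ne show False by (simp add: cong_iff_dvd_diff)
    qed
    ultimately have "[b = b'] (mod p)" by (simp add: cong_iff_dvd_diff)
    hence b: "b = b'" using l l' by (auto intro: cong_less_imp_eq_int)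
    have "p dvd c - c'"
      using dvd_diff[OF d(3,1)] b by (simp add: algebra_simps)
    hence "c = c'" using l l' by (auto intro: cong_less_imp_eq_int simp: cong_iff_dvd_diff)
    with b show ?thesis by simp
  qed
  hence "card ?S \<le> 1"
    by (subst card_le_Suc0_iff_eq[folded One_nat_def]) auto
  moreover have "(\<Sum>l\<in>{0..<p} \<times> {0..<p}. of_bool (incident p l z \<and> incident p l z')) = real (card ?S)"
    by (simp add: of_bool_def sum.If_cases Int_def)
  ultimately show ?thesis by simp
qed

text \<open>This is p^2 times the variance of the number of points on a random line. The sum of
  squares counts pairs of points with a common line: at most one line for distinct points,
  \<open>p\<close> lines for coinciding ones. Points are indexed by \<open>P\<close>, so that
  residues may repeat, with multiplicity at most \<open>m\<close>.\<close>

lemma incidence_second_moment: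
  fixes p :: int and z :: "'a \<Rightarrow> int \<times> int"
  assumes p: "prime p" and fin: "finite P"
  assumes mult: "\<And>i. i \<in> P \<Longrightarrow>
      card {j \<in> P. [fst (z i) = fst (z j)] (mod p) \<and> [snd (z i) = snd (z j)] (mod p)} \<le> m"
  shows "(\<Sum>l\<in>{0..<p} \<times> {0..<p}. ((\<Sum>i\<in>P. of_bool (incident p l (z i))) - real (card P) / p)\<^sup>2)
           \<le> m * p * card P"
proof -
  define Q where "Q = {0..<p} \<times> {0..<p}"
  define f :: "int \<times> int \<Rightarrow> real" where "f l = (\<Sum>i\<in>P. of_bool (incident p l (z i)))" for l
  have p0: "p > 0" using p by (simp add: prime_gt_0_int)
  have cardQ: "real (card Q) = real_of_int p * p"
    using p0 by (simp add: Q_def card_cartesian_product)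
  have s1: "(\<Sum>l\<in>Q. f l) = card P * p"
    unfolding f_def by (subst sum.swap) (simp add: Q_def card_lines_through[OF p0])
  have "(\<Sum>l\<in>Q. (f l)\<^sup>2) = (\<Sum>l\<in>Q. \<Sum>i\<in>P. \<Sum>j\<in>P. of_bool (incident p l (z i) \<and> incident p l (z j)))"
    unfolding f_def power2_eq_square sum_product by (simp add: of_bool_conj)
  also have "\<dots> = (\<Sum>i\<in>P. \<Sum>j\<in>P. \<Sum>l\<in>Q. of_bool (incident p l (z i) \<and> incident p l (z j)))"
    by (subst sum.swap) (intro sum.cong refl sum.swap)
  \<comment> \<open>A coinciding pair is charged 1 + p instead of p, so that the ones add up to
    exactly the square of \<open>card P\<close>.\<close>
  also have "\<dots> \<le> (\<Sum>i\<in>P. \<Sum>j\<in>P. 1 + real_of_int p *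
      of_bool ([fst (z i) = fst (z j)] (mod p) \<and> [snd (z i) = snd (z j)] (mod p)))"
  proof (intro sum_mono)
    fix i j
    show "(\<Sum>l\<in>Q. of_bool (incident p l (z i) \<and> incident p l (z j))) \<le> 1 + real_of_int p *
      of_bool ([fst (z i) = fst (z j)] (mod p) \<and> [snd (z i) = snd (z j)] (mod p))"
    proof (cases "[fst (z i) = fst (z j)] (mod p) \<and> [snd (z i) = snd (z j)] (mod p)")
      case True
      have "(\<Sum>l\<in>Q. of_bool (incident p l (z i) \<and> incident p l (z j)))
              \<le> (\<Sum>l\<in>Q. of_bool (incident p l (z i)) :: real)"
        by (intro sum_mono) auto
      also have "\<dots> = p" by (simp add: Q_def card_lines_through[OF p0])
      finally show ?thesis using True by simp
    next
      case False
      then have eq0: "of_bool ([fst (z i) = fst (z j)] (mod p) \<and> [snd (z i) = snd (z j)] (mod p)) = (0::real)"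
        by simp
      show ?thesis unfolding eq0 using card_lines_through_two[OF p False] by (simp add: Q_def)
    qed
  qed
  also have "\<dots> = (\<Sum>i\<in>P. card P + real_of_int p *
      card {j \<in> P. [fst (z i) = fst (z j)] (mod p) \<and> [snd (z i) = snd (z j)] (mod p)})"
    using fin by (simp add: sum.distrib sum_distrib_left [symmetric] of_bool_def sum.If_cases Int_def)
  also have "\<dots> \<le> (\<Sum>i\<in>P. real (card P) + p * m)"
    using mult p0 by (intro sum_mono) auto
  finally have s2: "(\<Sum>l\<in>Q. (f l)\<^sup>2) \<le> card P * (real (card P) + p * m)"
    by simp
  define c where "c = real (card P) / p"
  have "(\<Sum>l\<in>Q. (f l - c)\<^sup>2) = (\<Sum>l\<in>Q. (f l)\<^sup>2) - 2 * (\<Sum>l\<in>Q. f l) * c + card Q * c\<^sup>2"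
    by (simp add: power2_diff sum.distrib sum_subtractf flip: sum_distrib_left sum_distrib_right)
  \<comment> \<open>As \<open>c\<close> is the mean of \<open>f\<close> over the p^2 lines, the last
    two terms combine to minus the square of \<open>card P\<close>. This cancels the main term of
    \<open>s2\<close>.\<close>
  also have "\<dots> = (\<Sum>l\<in>Q. (f l)\<^sup>2) - (real (card P))\<^sup>2"
    using p0 unfolding s1 cardQ c_def by (simp add: power2_eq_square)
  also have "\<dots> \<le> m * p * card P"
    using s2 by (simp add: power2_eq_square algebra_simps)
  finally show ?thesis by (simp add: Q_def f_def c_def)
qed

text \<open>Cauchy-Schwarz over \<open>L\<close> reduces the deviation to a sum of squares. The
  lines are distinct modulo \<open>p\<close>, so this sum is part of the one over all lines, which
  the second moment bounds.\<close>

lemma incidence_bound: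
  fixes p :: int and z :: "'a \<Rightarrow> int \<times> int" and l :: "'b \<Rightarrow> int \<times> int"
  assumes p: "prime p" and fin: "finite P" and finL: "finite L"
  assumes mult: "\<And>i. i \<in> P \<Longrightarrow>
      card {j \<in> P. [fst (z i) = fst (z j)] (mod p) \<and> [snd (z i) = snd (z j)] (mod p)} \<le> m"
  assumes inj: "\<And>i j. i \<in> L \<Longrightarrow> j \<in> L \<Longrightarrow>
      [fst (l i) = fst (l j)] (mod p) \<Longrightarrow> [snd (l i) = snd (l j)] (mod p) \<Longrightarrow> i = j"
  shows "\<bar>card {(i, j) \<in> P \<times> L. incident p (l j) (z i)} - real (card P) * card L / p\<bar>
           \<le> sqrt (m * p * card P * card L)"
proof -
  define f :: "int \<times> int \<Rightarrow> real" where "f l = (\<Sum>i\<in>P. of_bool (incident p l (z i)))" for l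
  define r where "r j = (fst (l j) mod p, snd (l j) mod p)" for j
  have p0: "p > 0" using p by (simp add: prime_gt_0_int)
  have inc: "incident p (r j) w = incident p (l j) w" for j w
    by (simp add: incident_def r_def cong_def mod_simps)
  have rinj: "inj_on r L"
    using inj by (intro inj_onI) (auto simp: r_def cong_def)
  have "real (card {(i, j) \<in> P \<times> L. incident p (l j) (z i)})
      = (\<Sum>(i,j)\<in>P \<times> L. of_bool (incident p (l j) (z i)))"
    using fin finL by (simp add: of_bool_def sum.If_cases case_prod_unfold Int_def conj_assoc mem_Times_iff)
  also have "\<dots> = (\<Sum>j\<in>L. f (r j))"
    unfolding sum.cartesian_product [symmetric] f_def inc by (rule sum.swap)
  finally have "real (card {(i, j) \<in> P \<times> L. incident p (l j) (z i)}) - real (card P) * card L / p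
      = (\<Sum>j\<in>L. f (r j) - card P / p)"
    by (simp add: sum_subtractf)
  moreover have "(\<Sum>j\<in>L. f (r j) - card P / p)\<^sup>2 \<le> m * p * card P * card L"
  proof -
    have "(\<Sum>j\<in>L. f (r j) - card P / p)\<^sup>2 \<le> (\<Sum>j\<in>L. (f (r j) - card P / p)\<^sup>2) * card L"
      by (rule sum_squared_le_sum_of_squares)
    also have "(\<Sum>j\<in>L. (f (r j) - card P / p)\<^sup>2) = (\<Sum>k\<in>r ` L. (f k - card P / p)\<^sup>2)"
      using rinj by (simp add: sum.reindex)
    also have "\<dots> \<le> (\<Sum>k\<in>{0..<p} \<times> {0..<p}. (f k - card P / p)\<^sup>2)"
      using p0 by (intro sum_mono2) (auto simp: r_def)
    also have "\<dots> \<le> m * p * card P"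
      unfolding f_def by (rule incidence_second_moment[OF p fin mult])
    finally show ?thesis by (simp add: mult_right_mono)
  qed
  ultimately show ?thesis
    by (simp add: real_le_rsqrt)
qed

section \<open>Powers with integer exponents and primitive roots\<close>

text \<open>Clears denominators: a large enough power of \<open>g\<close> turns an integer power
  into an ordinary one, so later arguments avoid cases on signs.\<close>

lemma int_pow_mod_mult_power:
  assumes cop: "coprime g m" and nonneg: "x + int n \<ge> 0"
  shows "[int_pow_mod m g x * g ^ n = g ^ nat (x + int n)] (mod m)"
proof (cases "x \<ge> 0")
  case True
  then show ?thesis
    by (simp add: int_pow_mod_def nat_add_distrib power_add)
next
  case False
  define k where "k = nat (- x)"
  have n: "n = k + nat (x + int n)"
    using False nonneg by (simp add: k_def)
  have "int_pow_mod m g x * g ^ n = (modular_inverse m g * g) ^ k * g ^ nat (x + int n)"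
    using False by (subst n) (simp add: int_pow_mod_def k_def power_add power_mult_distrib)
  also have "[\<dots> = 1 ^ k * g ^ nat (x + int n)] (mod m)"
    by (intro cong_mult cong_pow cong_modular_inverse2 cop cong_refl)
  finally show ?thesis by simp
qed

lemma coprime_int_pow_mod:
  "coprime g m \<Longrightarrow> coprime (int_pow_mod m g x) m"
  by (auto simp: int_pow_mod_def intro: coprime_modular_inverse)

text \<open>After multiplication by \<open>g\<close> to the power |x| + |y| both sides are products
  of ordinary powers; the factor is a unit and cancels.\<close>

lemma int_pow_mod_add:
  assumes cop: "coprime g m"
  shows "[int_pow_mod m g (x + y) = int_pow_mod m g x * int_pow_mod m g y] (mod m)"
proof -
  define k l where "k = nat \<bar>x\<bar>" and "l = nat \<bar>y\<bar>"
  have "[int_pow_mod m g (x + y) * g ^ (k + l) = g ^ nat (x + y + int (k + l))] (mod m)"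
    by (rule int_pow_mod_mult_power[OF cop]) (auto simp: k_def l_def)
  also have "nat (x + y + int (k + l)) = nat (x + int k) + nat (y + int l)"
    by (auto simp: k_def l_def)
  also have "[g ^ (nat (x + int k) + nat (y + int l)) = (int_pow_mod m g x * g ^ k) * (int_pow_mod m g y * g ^ l)] (mod m)"
    unfolding power_add
    by (intro cong_mult cong_sym[OF int_pow_mod_mult_power[OF cop]]) (auto simp: k_def l_def)
  also have "(int_pow_mod m g x * g ^ k) * (int_pow_mod m g y * g ^ l)
      = (int_pow_mod m g x * int_pow_mod m g y) * g ^ (k + l)"
    by (simp add: power_add mult_ac)
  finally show ?thesis
    using cop by (simp add: cong_mult_rcancel)
qed

lemma int_residue_primrootD:
  assumes "int_residue_primroot p g" "p > 0"
  shows "coprime g (int p)"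
    and "[g ^ n = 1] (mod int p) \<Longrightarrow> totient p dvd n"
proof -
  define h where "h = nat (g mod int p)"
  have h: "int h = g mod int p" using assms(2) by (simp add: h_def)
  have root: "coprime p h" "ord p h = totient p"
    using assms by (auto simp: int_residue_primroot_def residue_primroot_def h_def)
  have "coprime (int h) (int p)" using root by (simp add: coprime_commute)
  then show "coprime g (int p)"
    unfolding h using assms(2) by (simp add: coprime_mod_left_iff)
  assume "[g ^ n = 1] (mod int p)"
  hence "[int h ^ n = 1] (mod int p)"
    unfolding h by (simp add: cong_def mod_simps)
  hence "[int (h ^ n) = int 1] (mod int p)" by simp
  hence "[h ^ n = 1] (mod p)" unfolding cong_int_iff .
  then show "totient p dvd n" using root by (simp add: ord_divides')
qed

text \<open>For x \<le> y the unit g^x cancels, leaving g^(y-x) = 1 with an ordinary exponent, which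
  the order of \<open>g\<close> must divide.\<close>

lemma int_pow_mod_cong_imp_cong:
  assumes "int_residue_primroot p g" "p > 0"
    and "[int_pow_mod (int p) g x = int_pow_mod (int p) g y] (mod int p)"
  shows "[x = y] (mod int (totient p))"
  using assms(3)
proof (induction x y rule: linorder_wlog)
  case (le x y)
  note cop = int_residue_primrootD(1)[OF assms(1,2)]
  have "[int_pow_mod (int p) g x * 1 = int_pow_mod (int p) g (x + (y - x))] (mod int p)"
    using le by simp
  also have "[int_pow_mod (int p) g (x + (y - x))
      = int_pow_mod (int p) g x * int_pow_mod (int p) g (y - x)] (mod int p)"
    by (rule int_pow_mod_add[OF cop])
  finally have "[int_pow_mod (int p) g (y - x) = 1] (mod int p)"
    using cong_mult_lcancel[OF coprime_int_pow_mod[OF cop]] by (metis cong_sym)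
  hence "totient p dvd nat (y - x)"
    using le by (intro int_residue_primrootD(2)[OF assms(1,2)]) (simp add: int_pow_mod_def)
  hence "int (totient p) dvd y - x"
    using le by (metis diff_ge_0_iff_ge int_dvd_int_iff int_nat_eq)
  then show ?case by (simp add: cong_iff_dvd_diff dvd_diff_commute)
next
  case (sym x y)
  then show ?case by (meson cong_sym)
qed

section \<open>Incidence bound for powers of a primitive root in long intervals\<close>

text \<open>The interval has at most 2q elements, so two blocks of length \<open>q\<close> starting
  at \<open>a\<close> cover it, and each block meets the class at most once. The map used is the
  block number.\<close>

lemma card_residue_class_le_2:
  fixes q x a b :: int
  assumes q: "q > 0" and len: "b - a < 2 * q"
  shows "card {y \<in> {a..b}. [x = y] (mod q)} \<le> 2"
proof -
  let ?S = "{y \<in> {a..b}. [x = y] (mod q)}"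
  have "inj_on (\<lambda>y. (y - a) div q) ?S"
  proof (rule inj_onI)
    fix y y' assume y: "y \<in> ?S" "y' \<in> ?S" and eq: "(y - a) div q = (y' - a) div q"
    have "[y = y'] (mod q)" using y by (auto intro: cong_trans cong_sym)
    hence "(y - a) mod q = (y' - a) mod q"
      using cong_diff[of y y' q a a] by (simp add: cong_def)
    with eq have "y - a = y' - a" by (metis mult_div_mod_eq)
    then show "y = y'" by simp
  qed
  moreover have "(\<lambda>y. (y - a) div q) ` ?S \<subseteq> {0, 1}"
  proof
    fix d assume "d \<in> (\<lambda>y. (y - a) div q) ` ?S"
    then obtain y where y: "y \<in> {a..b}" and d: "d = (y - a) div q" by auto
    have "d * q \<le> y - a"
      using q by (simp add: d flip: minus_mod_eq_div_mult)
    also have "\<dots> < 2 * q" using y len by auto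
    finally have "d < 2" using q by (simp add: mult_less_cancel_right)
    moreover have "0 \<le> d" using q y by (simp add: d pos_imp_zdiv_nonneg_iff)
    ultimately show "d \<in> {0, 1}" by auto
  qed
  ultimately have "card ?S \<le> card {0, 1 :: int}"
    by (intro card_inj_on_le[where f = "\<lambda>y. (y - a) div q"]) auto
  then show ?thesis by simp
qed

text \<open>The long intervals may hit a residue class twice, so points have multiplicity up to 4; hence the factor 2.\<close>

lemma shifted_count_bound:
  fixes A B C D :: int
  assumes p: "prime p" and g: "int_residue_primroot p g"
    and A: "B - A < 2 * (int p - 1)" and C: "D - C < 2 * int p"
    and k: "0 \<le> k" "k < int p" and n: "0 \<le> n" "n < int p"
  shows "\<bar>card {(z, w) \<in> ({A..B} \<times> {C..D}) \<times> ({1..k} \<times> {1..n}).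
              [int_pow_mod p g (fst z + fst w) = snd z + snd w] (mod int p)}
           - real (nat (B - A + 1) * nat (D - C + 1)) * (real_of_int k * n) / p\<bar>
         \<le> 2 * sqrt (real p * real (nat (B - A + 1) * nat (D - C + 1)) * (real_of_int k * n))"
proof -
  define e where "e = int_pow_mod (int p) g"
  have p0: "p > 0" using p prime_gt_0_nat by blast
  have tot: "int (totient p) = int p - 1" "int p - 1 > 0"
    using p prime_gt_1_nat[OF p] by (auto simp: totient_prime)
  note cop = int_residue_primrootD(1)[OF g p0]
  \<comment> \<open>Exponents repeat with period p - 1 but second coordinates with period p; hence
    the different length conditions on the two long intervals.\<close>
  have eD: "[x = y] (mod (int p - 1))" if "[e x = e y] (mod int p)" for x y
    using int_pow_mod_cong_imp_cong[OF g p0] that by (simp add: e_def tot)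
  have inc: "incident p (e (fst w), snd w) (e (fst z), snd z)
      \<longleftrightarrow> [int_pow_mod p g (fst z + fst w) = snd z + snd w] (mod int p)" for z w
    using int_pow_mod_add[OF cop, of "fst z" "fst w"]
    unfolding incident_def e_def by (simp add: cong_def mult.commute)
  have "\<bar>card {(z, w) \<in> ({A..B} \<times> {C..D}) \<times> ({1..k} \<times> {1..n}).
              incident p (e (fst w), snd w) (e (fst z), snd z)}
          - real (card ({A..B} \<times> {C..D})) * card ({1..k} \<times> {1..n}) / int p\<bar>
         \<le> sqrt ((4::nat) * int p * card ({A..B} \<times> {C..D}) * card ({1..k} \<times> {1..n}))"
  proof (rule incidence_bound)
    fix i assume "i \<in> {A..B} \<times> {C..D}"
    let ?S1 = "{y \<in> {A..B}. [fst i = y] (mod (int p - 1))}"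
    let ?S2 = "{y \<in> {C..D}. [snd i = y] (mod int p)}"
    have "card {j \<in> {A..B} \<times> {C..D}.
        [fst (e (fst i), snd i) = fst (e (fst j), snd j)] (mod int p) \<and>
        [snd (e (fst i), snd i) = snd (e (fst j), snd j)] (mod int p)} \<le> card (?S1 \<times> ?S2)"
      by (intro card_mono finite_cartesian_product
          finite_subset[of ?S1 "{A..B}"] finite_subset[of ?S2 "{C..D}"]) (auto dest: eD)
    also have "\<dots> = card ?S1 * card ?S2"
      by (rule card_cartesian_product)
    also have "\<dots> \<le> 2 * 2"
      using A C tot p0 by (intro mult_mono card_residue_class_le_2) auto
    finally show "card {j \<in> {A..B} \<times> {C..D}.
        [fst (e (fst i), snd i) = fst (e (fst j), snd j)] (mod int p) \<and>
        [snd (e (fst i), snd i) = snd (e (fst j), snd j)] (mod int p)} \<le> 4" by simp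
  next
    fix i j assume ij: "i \<in> {1..k} \<times> {1..n}" "j \<in> {1..k} \<times> {1..n}"
      "[fst (e (fst i), snd i) = fst (e (fst j), snd j)] (mod int p)"
      "[snd (e (fst i), snd i) = snd (e (fst j), snd j)] (mod int p)"
    \<comment> \<open>Exponents from 1 to k \<le> p - 1 are shifted down by one to become least
      residues modulo p - 1.\<close>
    have "[fst i - 1 = fst j - 1] (mod (int p - 1))"
      using ij by (auto intro!: cong_diff dest: eD)
    hence "fst i - 1 = fst j - 1"
      using ij k by (intro cong_less_imp_eq_int) auto
    moreover have "snd i = snd j"
      using ij n by (intro cong_less_imp_eq_int[where m = "int p"]) auto
    ultimately show "i = j" by (simp add: prod_eq_iff)
  qed (use p in auto)
  also have "\<dots> = 2 * sqrt (real p * real (nat (B - A + 1) * nat (D - C + 1)) * (real_of_int k * n))"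
    using k n by (simp add: card_cartesian_product real_sqrt_mult mult_ac)
  finally show ?thesis
    using k n by (simp add: card_cartesian_product inc mult_ac)
qed

section \<open>Bounding the count from both sides by shifted intervals\<close>

definition exp_count :: "nat \<Rightarrow> int \<Rightarrow> int \<Rightarrow> int \<Rightarrow> int \<Rightarrow> int \<Rightarrow> nat" where
  "exp_count p g H K M N =
     card {x \<in> {H + 1..H + K}. \<exists>y \<in> {M + 1..M + N}. [int_pow_mod p g x = y] (mod int p)}"

text \<open>At most \<open>p\<close> consecutive integers contain at most one representative
  \<open>y\<close> of each class, so the witness is unique. Pairs are what the incidence count
  compares with.\<close>

lemma exp_count_eq_card_pairs:
  assumes "N \<le> int p"
  shows "exp_count p g H K M N =
    card {(x, y) \<in> {H + 1..H + K} \<times> {M + 1..M + N}. [int_pow_mod p g x = y] (mod int p)}"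
proof -
  let ?G = "{(x, y) \<in> {H + 1..H + K} \<times> {M + 1..M + N}. [int_pow_mod p g x = y] (mod int p)}"
  have "inj_on fst ?G"
  proof (rule inj_onI, clarsimp)
    fix x y y'
    assume *: "M + 1 \<le> y" "y \<le> M + N" "M + 1 \<le> y'" "y' \<le> M + N"
      "[int_pow_mod p g x = y] (mod int p)" "[int_pow_mod p g x = y'] (mod int p)"
    have "[y - (M + 1) = y' - (M + 1)] (mod int p)"
      using * by (meson cong_diff cong_refl cong_sym cong_trans)
    hence "y - (M + 1) = y' - (M + 1)"
      by (rule cong_less_imp_eq_int[rotated 4]) (use * assms in auto)
    then show "y = y'" by simp
  qed
  moreover have "fst ` ?G =
      {x \<in> {H + 1..H + K}. \<exists>y \<in> {M + 1..M + N}. [int_pow_mod p g x = y] (mod int p)}"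
    by force
  ultimately show ?thesis
    using card_image[of fst ?G] by (simp only: exp_count_def)
qed

text \<open>Used with q = k n to divide the incidence error by the number of shifts.\<close>

lemma sqrt_mult_divide_self:
  fixes a q :: real
  assumes "q > 0"
  shows "sqrt (a * q) = q * sqrt (a / q)"
proof -
  have "a * q = q\<^sup>2 * (a / q)" using assms by (simp add: power2_eq_square)
  then show ?thesis using assms by (simp only: real_sqrt_mult real_sqrt_abs abs_of_pos)
qed

text \<open>\<open>k\<close> and \<open>n\<close> are the numbers of shifts. With k \<le> K < p and
  n \<le> N < p, even the enlarged intervals, of K + k and N + n elements, satisfy the length
  conditions of \<open>shifted_count_bound\<close>.\<close>

locale exp_interval =
  fixes p :: nat and g H K M N k n :: int
  assumes p: "prime p" and g: "int_residue_primroot p g"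
    and KN: "K < int p" "N < int p"
    and k: "1 \<le> k" "k \<le> K" and n: "1 \<le> n" "n \<le> N"
begin

text \<open>Shifting a solution (x, y) back by any (a, b) stays in the enlarged box, so each
  solution yields k n different incidences.\<close>

lemma exp_count_upper:
  "exp_count p g H K M N \<le> (K + k) * (N + n) / p + 2 * sqrt (real p * ((K + k) * (N + n)) / (real_of_int k * n))"
proof -
  define T where "T = {(z, w) \<in> ({H + 1 - k..H + K} \<times> {M + 1 - n..M + N}) \<times> ({1..k} \<times> {1..n}).
              [int_pow_mod p g (fst z + fst w) = snd z + snd w] (mod int p)}"
  define G where "G = {(x, y) \<in> {H + 1..H + K} \<times> {M + 1..M + N}. [int_pow_mod p g x = y] (mod int p)}"
  define S where "S = (real_of_int K + k) * (real_of_int N + n)"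
  have "card G * (nat k * nat n) = card (G \<times> ({1..k} \<times> {1..n}))"
    by (simp add: card_cartesian_product)
  also have "\<dots> \<le> card T"
  proof (rule card_inj_on_le[where f = "\<lambda>((x, y), (a, b)). ((x - a, y - b), (a, b))"])
    show "finite T"
      by (rule finite_subset[of _ "({H + 1 - k..H + K} \<times> {M + 1 - n..M + N}) \<times> ({1..k} \<times> {1..n})"])
        (auto simp: T_def)
  qed (auto simp: inj_on_def G_def T_def)
  finally have "real (card G * (nat k * nat n)) \<le> card T" by (simp only: of_nat_le_iff)
  moreover have "\<bar>card T - real (nat (H + K - (H + 1 - k) + 1) * nat (M + N - (M + 1 - n) + 1)) * (real_of_int k * n) / p\<bar>
      \<le> 2 * sqrt (real p * real (nat (H + K - (H + 1 - k) + 1) * nat (M + N - (M + 1 - n) + 1)) * (real_of_int k * n))"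
    unfolding T_def by (rule shifted_count_bound[OF p g]) (use KN k n in auto)
  moreover have "real (nat (H + K - (H + 1 - k) + 1) * nat (M + N - (M + 1 - n) + 1)) = S"
    using k n by (simp add: S_def)
  moreover have "sqrt (real p * S * (real_of_int k * n)) = real_of_int k * n * sqrt (real p * S / (real_of_int k * n))"
    using k n by (intro sqrt_mult_divide_self) auto
  ultimately have "card G * (real_of_int k * n) \<le> S * (real_of_int k * n) / p + 2 * (real_of_int k * n * sqrt (real p * S / (real_of_int k * n)))"
    using k n by (simp add: mult_ac)
  also have "\<dots> = (S / p + 2 * sqrt (real p * S / (real_of_int k * n))) * (real_of_int k * n)"
    by (simp add: algebra_simps)
  finally have "card G \<le> S / p + 2 * sqrt (real p * S / (real_of_int k * n))"
    using k n by (simp add: mult_le_cancel_right)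
  then show ?thesis
    using KN by (simp add: exp_count_eq_card_pairs G_def S_def)
qed

text \<open>Conversely, shifting a point of the shrunk box forward by (a, b) stays in the original
  box, so each solution arises from at most k n incidences. For k = K or n = N the shrunk box is
  empty and the bound is trivial.\<close>

lemma exp_count_lower:
  "exp_count p g H K M N \<ge> (K - k) * (N - n) / p - 2 * sqrt (real p * ((K - k) * (N - n)) / (real_of_int k * n))"
proof -
  define T where "T = {(z, w) \<in> ({H + 1..H + (K - k)} \<times> {M + 1..M + (N - n)}) \<times> ({1..k} \<times> {1..n}).
              [int_pow_mod p g (fst z + fst w) = snd z + snd w] (mod int p)}"
  define G where "G = {(x, y) \<in> {H + 1..H + K} \<times> {M + 1..M + N}. [int_pow_mod p g x = y] (mod int p)}"
  define S where "S = (real_of_int K - k) * (real_of_int N - n)"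
  have "card T \<le> card (G \<times> ({1..k} \<times> {1..n}))"
  proof (rule card_inj_on_le[where f = "\<lambda>((x, y), (a, b)). ((x + a, y + b), (a, b))"])
    show "finite (G \<times> ({1..k} \<times> {1..n}))"
      by (rule finite_subset[of _ "({H + 1..H + K} \<times> {M + 1..M + N}) \<times> ({1..k} \<times> {1..n})"])
        (auto simp: G_def)
  qed (auto simp: inj_on_def G_def T_def)
  also have "\<dots> = card G * (nat k * nat n)"
    by (simp add: card_cartesian_product)
  finally have "card T \<le> real (card G * (nat k * nat n))" by (simp only: of_nat_le_iff)
  moreover have "\<bar>card T - real (nat (H + (K - k) - (H + 1) + 1) * nat (M + (N - n) - (M + 1) + 1)) * (real_of_int k * n) / p\<bar>
      \<le> 2 * sqrt (real p * real (nat (H + (K - k) - (H + 1) + 1) * nat (M + (N - n) - (M + 1) + 1)) * (real_of_int k * n))"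
    unfolding T_def by (rule shifted_count_bound[OF p g]) (use KN k n in auto)
  moreover have "real (nat (H + (K - k) - (H + 1) + 1) * nat (M + (N - n) - (M + 1) + 1)) = S"
    using k n by (simp add: S_def)
  moreover have "sqrt (real p * S * (real_of_int k * n)) = real_of_int k * n * sqrt (real p * S / (real_of_int k * n))"
    using k n by (intro sqrt_mult_divide_self) auto
  ultimately have "S * (real_of_int k * n) / p - 2 * (real_of_int k * n * sqrt (real p * S / (real_of_int k * n))) \<le> card G * (real_of_int k * n)"
    using k n by (simp add: mult_ac)
  also have "S * (real_of_int k * n) / p - 2 * (real_of_int k * n * sqrt (real p * S / (real_of_int k * n)))
      = (S / p - 2 * sqrt (real p * S / (real_of_int k * n))) * (real_of_int k * n)"
    by (simp add: algebra_simps)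
  finally have "S / p - 2 * sqrt (real p * S / (real_of_int k * n)) \<le> card G"
    using k n by (simp add: mult_le_cancel_right)
  then show ?thesis
    using KN by (simp add: exp_count_eq_card_pairs G_def S_def)
qed

text \<open>The factor 2 in the hypotheses leaves room for rounding \<alpha> K and \<alpha> N up to
  integers. The constant 8 is 2 + 2 + 4, from the three extra terms of (K + k)(N + n).\<close>

lemma exp_count_deviation:
  fixes \<alpha> :: real
  assumes \<alpha>: "0 < \<alpha>" "\<alpha> \<le> 1"
    and kb: "\<alpha> * K \<le> k" "k \<le> 2 * \<alpha> * K" and nb: "\<alpha> * N \<le> n" "n \<le> 2 * \<alpha> * N"
  shows "\<bar>exp_count p g H K M N - real_of_int K * N / p\<bar> \<le> 8 * (\<alpha> * K * N / p) + 4 * (sqrt p / \<alpha>)"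
proof -
  define x y where "x = real_of_int K" and "y = real_of_int N"
  define a b where "a = real_of_int k" and "b = real_of_int n"
  have p0: "real p > 0" using p prime_gt_0_nat by auto
  have pos: "0 < a" "a \<le> x" "0 < b" "b \<le> y" "0 < x" "0 < y"
    using k n by (auto simp: x_def y_def a_def b_def)
  have ab: "\<alpha> * x \<le> a" "a \<le> 2 * \<alpha> * x" "\<alpha> * y \<le> b" "b \<le> 2 * \<alpha> * y"
    using kb nb by (auto simp: x_def y_def a_def b_def)
  \<comment> \<open>Both boxes have size at most 4 K N, while k n is at least \<alpha>^2 K
    N.\<close>
  have err: "2 * sqrt (p * S / (a * b)) \<le> 4 * (sqrt p / \<alpha>)" if "S \<le> 4 * (x * y)" for S :: real
  proof -
    have "\<alpha>\<^sup>2 * (x * y) \<le> a * b"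
      using mult_mono[OF ab(1,3)] pos \<alpha> by (simp add: power2_eq_square mult_ac)
    hence "\<alpha>\<^sup>2 * S \<le> 4 * (a * b)"
      using mult_left_mono[OF that, of "\<alpha>\<^sup>2"] by simp
    hence "p * S / (a * b) \<le> 4 * p / \<alpha>\<^sup>2"
      using pos \<alpha> p0 by (simp add: field_simps)
    hence "sqrt (p * S / (a * b)) \<le> sqrt (4 * p / \<alpha>\<^sup>2)" by (rule real_sqrt_le_mono)
    also have "\<dots> = 2 * (sqrt p / \<alpha>)"
      using \<alpha> by (simp add: real_sqrt_mult real_sqrt_divide)
    finally show ?thesis by simp
  qed
  have ay: "a * y \<le> 2 * (\<alpha> * x * y)" and bx: "b * x \<le> 2 * (\<alpha> * x * y)"
    using mult_right_mono[OF ab(2), of y] mult_right_mono[OF ab(4), of x] pos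
    by (simp_all add: mult_ac)
  have "a * b \<le> 2 * \<alpha> * x * b"
    using ab(2) pos by (intro mult_right_mono) auto
  \<comment> \<open>Only one factor \<alpha> is kept, so that all three terms are linear in
    \<alpha>.\<close>
  also have "\<dots> \<le> 2 * \<alpha> * x * (2 * y)"
    using pos \<alpha> by (intro mult_left_mono) auto
  finally have abxy: "a * b \<le> 4 * (\<alpha> * x * y)" by simp
  have "(x + a) * (y + b) \<le> (2 * x) * (2 * y)"
    using pos by (intro mult_mono) auto
  hence S1: "(x + a) * (y + b) \<le> 4 * (x * y)" by simp
  have "(x - a) * (y - b) \<le> x * y"
    using pos by (intro mult_mono) auto
  moreover have "0 < x * y" using pos by simp
  ultimately have S2: "(x - a) * (y - b) \<le> 4 * (x * y)" by linarith
  have "(x + a) * (y + b) \<le> x * y + 8 * (\<alpha> * x * y)"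
    using ay bx abxy by (simp add: algebra_simps)
  hence "(x + a) * (y + b) / p \<le> x * y / p + 8 * (\<alpha> * x * y / p)"
    using p0 divide_right_mono[of _ _ "real p"] by (fastforce simp: add_divide_distrib)
  with exp_count_upper err[OF S1]
  have up: "exp_count p g H K M N - x * y / p \<le> 8 * (\<alpha> * x * y / p) + 4 * (sqrt p / \<alpha>)"
    by (simp add: x_def y_def a_def b_def)
  have "x * y - 8 * (\<alpha> * x * y) \<le> (x - a) * (y - b)"
  proof -
    have "0 < a * b" "0 < \<alpha> * x * y" using pos \<alpha> by simp_all
    moreover have "(x - a) * (y - b) = x * y - a * y - b * x + a * b" by (simp add: algebra_simps)
    ultimately show ?thesis using ay bx by linarith
  qed
  hence "x * y / p - 8 * (\<alpha> * x * y / p) \<le> (x - a) * (y - b) / p"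
    using p0 divide_right_mono[of _ _ "real p"] by (fastforce simp: diff_divide_distrib)
  with exp_count_lower err[OF S2]
  have "x * y / p - exp_count p g H K M N \<le> 8 * (\<alpha> * x * y / p) + 4 * (sqrt p / \<alpha>)"
    by (simp add: x_def y_def a_def b_def)
  with up show ?thesis by (simp add: x_def y_def)
qed

end

section \<open>Choice of the shift lengths\<close>

text \<open>For K N \<ge> p^(3/2) a suitable \<alpha> makes both errors multiples of D; otherwise
  \<alpha> = 1 makes both at most multiples of sqrt p. Either way 12 is 8 + 4.\<close>

lemma exp_count_bound:
  assumes p: "prime p" and g: "int_residue_primroot p g"
    and N: "1 \<le> N" "N < int p" and K: "1 \<le> K" "K < int p"
  shows "\<bar>exp_count p g H K M N - real_of_int K * N / p\<bar>
    \<le> 12 * (sqrt K * sqrt N / p powr (1/4) + sqrt p)"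
proof -
  define x y P where "x = real_of_int K" and "y = real_of_int N" and "P = real p"
  have pos: "P > 0" "x > 0" "y > 0" "x < P" "y < P"
    using p prime_gt_0_nat N K by (auto simp: x_def y_def P_def)
  define D where "D = sqrt (x * y) / P powr (1/4)"
  have D: "sqrt K * sqrt N / p powr (1/4) = D" "D > 0"
    using pos by (simp_all add: D_def x_def y_def P_def real_sqrt_mult)
  show ?thesis
  proof (cases "x * y \<ge> P powr (3/2)")
    case True
    \<comment> \<open>Solves \<alpha> K N / p = sqrt p / \<alpha>; the common value is
      \<open>D\<close>, as \<open>E1\<close> and \<open>E2\<close> show.\<close>
    define \<alpha> where "\<alpha> = P powr (3/4) / sqrt (x * y)"
    have xy: "x * y > 0" using pos by simp
    have powr1: "(P powr (3/4))\<^sup>2 = P powr (3/2)" "P powr (3/4) * P powr (1/4) = P"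
      using pos by (simp_all add: powr_power flip: powr_add)
    have "sqrt (x * y) \<ge> P powr (3/4)"
      using True powr1(1) by (intro real_le_rsqrt) simp
    hence \<alpha>: "0 < \<alpha>" "\<alpha> \<le> 1" using pos by (simp_all add: \<alpha>_def)
    have E1: "\<alpha> * x * y / P = D"
    proof -
      have "\<alpha> * sqrt (x * y) = P powr (3/4)"
        using pos by (simp add: \<alpha>_def)
      moreover have "x * y = sqrt (x * y) * sqrt (x * y)" using xy by simp
      ultimately have "\<alpha> * x * y / P = P powr (3/4) * sqrt (x * y) / P"
        by (metis mult.assoc)
      also have "\<dots> = P powr (3/4) * sqrt (x * y) / (P powr (3/4) * P powr (1/4))"
        unfolding powr1(2) ..
      also have "\<dots> = D" using pos by (simp add: D_def)
      finally show ?thesis .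
    qed
    have E2: "sqrt P / \<alpha> = D"
    proof -
      have "sqrt P / \<alpha> = sqrt (x * y) * (P powr (1/2) / P powr (3/4))"
        using pos by (simp add: \<alpha>_def powr_half_sqrt)
      also have "P powr (1/2) / P powr (3/4) = 1 / P powr (1/4)"
        using pos by (simp add: powr_minus_divide flip: powr_diff)
      finally show ?thesis by (simp add: D_def)
    qed
    \<comment> \<open>Here \<alpha> u = p^(3/4) sqrt (u / v), and v < p \<le> p^(3/2) u.\<close>
    have large: "1 \<le> \<alpha> * u" if u: "u \<ge> 1" "v > 0" "v < P" and uv: "u * v = x * y" for u v
    proof -
      have "v \<le> P powr 1" using u pos by simp
      also have "\<dots> \<le> P powr (3/2)" using pos K by (intro powr_mono) (auto simp: P_def)
      finally have "v \<le> P powr (3/2) * u"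
        using u mult_left_mono[of 1 u "P powr (3/2)"] by linarith
      hence "x * y \<le> u * (P powr (3/2) * u)"
        unfolding uv[symmetric] using u by (intro mult_left_mono) auto
      also have "\<dots> = (P powr (3/4) * u)\<^sup>2"
        unfolding power_mult_distrib powr1(1) by (simp add: power2_eq_square)
      finally have "sqrt (x * y) \<le> P powr (3/4) * u"
        using u by (intro real_le_lsqrt) auto
      then show ?thesis using xy by (simp add: \<alpha>_def field_simps)
    qed
    have al: "1 \<le> \<alpha> * x" "1 \<le> \<alpha> * y"
      using large[of x y] large[of y x] pos N K by (auto simp: mult.commute x_def y_def)
    \<comment> \<open>Rounding up at most doubles a number that is at least 1, and \<alpha> \<le> 1
      keeps the result within \<open>L\<close>.\<close>
    have ceil: "1 \<le> \<lceil>\<alpha> * L\<rceil>" "\<lceil>\<alpha> * L\<rceil> \<le> L" "\<alpha> * L \<le> \<lceil>\<alpha> * L\<rceil>" "\<lceil>\<alpha> * L\<rceil> \<le> 2 * \<alpha> * L"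
      if "1 \<le> \<alpha> * L" "L > 0" for L :: int
    proof -
      have "\<alpha> * L \<le> 1 * real_of_int L" using \<alpha> that by (intro mult_right_mono) auto
      then show "\<lceil>\<alpha> * L\<rceil> \<le> L" by (simp add: ceiling_le_iff)
      show "1 \<le> \<lceil>\<alpha> * L\<rceil>" "\<alpha> * L \<le> \<lceil>\<alpha> * L\<rceil>" "\<lceil>\<alpha> * L\<rceil> \<le> 2 * \<alpha> * L"
        using that by linarith+
    qed
    interpret exp_interval p g H K M N "\<lceil>\<alpha> * K\<rceil>" "\<lceil>\<alpha> * N\<rceil>"
      using p g N K ceil[of K] ceil[of N] al by unfold_locales (auto simp: x_def y_def)
    have "\<bar>exp_count p g H K M N - real_of_int K * N / p\<bar> \<le> 8 * (\<alpha> * K * N / p) + 4 * (sqrt p / \<alpha>)"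
      using \<alpha> ceil[of K] ceil[of N] al N K by (intro exp_count_deviation) (auto simp: x_def y_def)
    also have "\<dots> = 12 * D"
      using E1 E2 by (simp add: x_def y_def P_def)
    also have "\<dots> \<le> 12 * (D + sqrt p)" by simp
    finally show ?thesis unfolding D .
  next
    case False
    \<comment> \<open>With full-length shifts, K N < p^(3/2) already makes the main term K N / p
      smaller than sqrt p.\<close>
    interpret exp_interval p g H K M N K N
      using p g N K by unfold_locales auto
    have "x * y / P \<le> P powr (3/2) / P powr 1"
      using False pos by (simp add: divide_right_mono)
    also have "\<dots> = P powr (1/2)" by (simp only: flip: powr_diff) simp
    also have "\<dots> = sqrt P" using pos by (simp add: powr_half_sqrt)
    finally have "8 * (1 * x * y / P) + 4 * (sqrt P / 1) \<le> 12 * sqrt P" by simp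
    moreover have "\<bar>exp_count p g H K M N - real_of_int K * N / p\<bar> \<le> 8 * (1 * real_of_int K * N / p) + 4 * (sqrt p / 1)"
      using N K by (intro exp_count_deviation) auto
    ultimately show ?thesis
      unfolding D using D(2) by (simp add: x_def y_def P_def)
  qed
qed

theorem theorem1:
  shows "\<exists>C::real. C > 0 \<and>
    (\<forall>(p::nat) (g::int) (N::int) (K::int) (M::int) (H::int) (J::nat).
      prime p \<longrightarrow> int_residue_primroot p g \<longrightarrow>
      1 \<le> N \<longrightarrow> N < int p \<longrightarrow> 1 \<le> K \<longrightarrow> K < int p \<longrightarrow>
      J = card {x \<in> {H + 1..H + K}. \<exists>y \<in> {M + 1..M + N}.
                  [int_pow_mod (int p) g x = y] (mod int p)} \<longrightarrow>
      \<bar>real J - real_of_int K * real_of_int N / real p\<bar>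
        \<le> C * (sqrt (real_of_int K) * sqrt (real_of_int N) / real p powr (1/4)
                + sqrt (real p)))"
proof (intro exI[of _ 12] conjI allI impI)
  fix p J :: nat and g N K M H :: int
  assume "prime p" "int_residue_primroot p g" "1 \<le> N" "N < int p" "1 \<le> K" "K < int p"
    and J: "J = card {x \<in> {H + 1..H + K}. \<exists>y \<in> {M + 1..M + N}.
                  [int_pow_mod (int p) g x = y] (mod int p)}"
  then show "\<bar>real J - real_of_int K * real_of_int N / real p\<bar>
        \<le> 12 * (sqrt (real_of_int K) * sqrt (real_of_int N) / real p powr (1/4) + sqrt (real p))"
    unfolding J exp_count_def[symmetric] by (intro exp_count_bound)
qed simp

end
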